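(* Let $(X,\|\cdot\|_X)$ be a $K$-convex complex Banach space. For every $p\in(1,\infty)$ there exists $c(p,X)\in(0,\infty)$ such that for every $n,d,m\in\mathbb{N}$ with $d+m\leq n$ and every function $f:\{-1,1\}^n\to X$ of degree at most $d+m$ which is also in the $d$-th tail space, we have $$\|\Delta f\|_{L_p(\{-1,1\}^n;X)}\geq c(p,X)\,\frac dm\,\|f\|_{L_p(\{-1,1\}^n;X)}.$$
   Context: $\mathbb{N}=\{1,2,\ldots\}$. For $p\in[1,\infty)$, $\|f\|_{L_p(\{-1,1\}^n;X)}=\big(2^{-n}\sum_{\varepsilon\in\{-1,1\}^n}\|f(\varepsilon)\|_X^p\big)^{1/p}$. For $A\subseteq\{1,\ldots,n\}$, the Walsh function is $w_A(\varepsilon)=\prod_{i\in A}\varepsilon_i$. Every $f:\{-1,1\}^n\to X$ has the expansion $f=\sum_{A}\widehat f(A)w_A$ with $\widehat f(A)=2^{-n}\sum_{\delta\in\{-1,1\}^n}f(\delta)w_A(\delta)\in X$. The hypercube Laplacian is $\Delta f=\sum_A|A|\widehat f(A)w_A$. A function $f$ has degree at most $k$ if $\widehat f(A)=0$ whenever $|A|>k$, and belongs to the $d$-th tail space if $\widehat f(A)=0$ whenever $|A|<d$. The Rademacher projection is $\mathsf{Rad}(f)(\varepsilon)=\sum_{i=1}^n\widehat f(\{i\})\varepsilon_i$. $X$ is $K$-convex if $\sup_{n\in\mathbb{N}}\|\mathsf{Rad}\|_{L_p(\{-1,1\}^n;X)\to L_p(\{-1,1\}^n;X)}<\infty$ for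 some (equivalently, for all) $p\in(1,\infty)$. *)

theory Defs
  imports "HOL-Analysis.Analysis"
begin

class complex_banach = banach +
  fixes scaleC :: "complex \<Rightarrow> 'a \<Rightarrow> 'a"  (infixr "*\<^sub>C" 75)
  assumes scaleC_add_right: "a *\<^sub>C (x + y) = a *\<^sub>C x + a *\<^sub>C y"
    and scaleC_add_left: "(a + b) *\<^sub>C x = a *\<^sub>C x + b *\<^sub>C x"
    and scaleC_scaleC: "a *\<^sub>C b *\<^sub>C x = (a * b) *\<^sub>C x"
    and scaleC_one: "1 *\<^sub>C x = x"
    and scaleR_scaleC: "r *\<^sub>R x = complex_of_real r *\<^sub>C x"
    and norm_scaleC: "norm (a *\<^sub>C x) = cmod a * norm x"

text \<open>A function on the \<open>n\<close>-cube is represented by a function on the whole type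
  \<^typ>\<open>nat \<Rightarrow> real\<close>; only its values on \<open>cube n\<close> are ever used below.\<close>

definition cube :: "nat \<Rightarrow> (nat \<Rightarrow> real) set" where
  "cube n = {1..n} \<rightarrow>\<^sub>E {-1, 1}"

definition cube_norm :: "nat \<Rightarrow> real \<Rightarrow> ((nat \<Rightarrow> real) \<Rightarrow> 'a::real_normed_vector) \<Rightarrow> real" where
  "cube_norm n p f = ((1 / 2 ^ n) * (\<Sum>\<epsilon>\<in>cube n. norm (f \<epsilon>) powr p)) powr (1 / p)"

definition walsh :: "nat set \<Rightarrow> (nat \<Rightarrow> real) \<Rightarrow> real" where
  "walsh A \<epsilon> = (\<Prod>i\<in>A. \<epsilon> i)"

definition walsh_coeff ::
    "nat \<Rightarrow> ((nat \<Rightarrow> real) \<Rightarrow> 'a::real_normed_vector) \<Rightarrow> nat set \<Rightarrow> 'a" where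
  "walsh_coeff n f A = (1 / 2 ^ n) *\<^sub>R (\<Sum>\<delta>\<in>cube n. walsh A \<delta> *\<^sub>R f \<delta>)"

definition laplacian ::
    "nat \<Rightarrow> ((nat \<Rightarrow> real) \<Rightarrow> 'a::real_normed_vector) \<Rightarrow> (nat \<Rightarrow> real) \<Rightarrow> 'a" where
  "laplacian n f \<epsilon> = (\<Sum>A\<in>Pow {1..n}. real (card A) *\<^sub>R walsh A \<epsilon> *\<^sub>R walsh_coeff n f A)"

definition degree_at_most ::
    "nat \<Rightarrow> nat \<Rightarrow> ((nat \<Rightarrow> real) \<Rightarrow> 'a::real_normed_vector) \<Rightarrow> bool" where
  "degree_at_most n k f \<longleftrightarrow> (\<forall>A\<subseteq>{1..n}. card A > k \<longrightarrow> walsh_coeff n f A = 0)"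

definition in_tail_space ::
    "nat \<Rightarrow> nat \<Rightarrow> ((nat \<Rightarrow> real) \<Rightarrow> 'a::real_normed_vector) \<Rightarrow> bool" where
  "in_tail_space n d f \<longleftrightarrow> (\<forall>A\<subseteq>{1..n}. card A < d \<longrightarrow> walsh_coeff n f A = 0)"

definition rad ::
    "nat \<Rightarrow> ((nat \<Rightarrow> real) \<Rightarrow> 'a::real_normed_vector) \<Rightarrow> (nat \<Rightarrow> real) \<Rightarrow> 'a" where
  "rad n f \<epsilon> = (\<Sum>i=1..n. \<epsilon> i *\<^sub>R walsh_coeff n f {i})"

definition rad_opnorm :: "'a::real_normed_vector itself \<Rightarrow> nat \<Rightarrow> real \<Rightarrow> ereal" where
  "rad_opnorm _ n p =
     (SUP f \<in> {f :: (nat \<Rightarrow> real) \<Rightarrow> 'a. cube_norm n p f \<le> 1}. ereal (cube_norm n p (rad n f)))"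

text \<open>The condition does not depend on \<open>p \<in> (1, \<infinity>)\<close>; it is stated in its formally weakest form.\<close>

definition K_convex :: "'a::real_normed_vector itself \<Rightarrow> bool" where
  "K_convex X \<longleftrightarrow> (\<exists>p>1. (SUP n\<in>{1..}. rad_opnorm X n p) < \<infinity>)"

end

theory Submission
  imports Defs
begin

text \<open>
  Write \<open>f = \<Sum>\<^sub>A w\<^sub>A x\<^sub>A\<close> and let \<open>P\<^sub>r f = \<Sum>\<^sub>A r^|A| w\<^sub>A x\<^sub>A\<close> be the noise operator (the heat
  semigroup at time \<open>log (1/r)\<close>).  For \<open>0 \<le> r \<le> 1\<close> it averages \<open>f\<close> against a doubly stochastic
  kernel, hence contracts every \<open>L\<^sub>p\<close> norm.  This alone yields two estimates that pull against
  each other at time \<open>T = 8m/d\<close>.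

  Since the semigroup consists of contractions and has generator \<open>-\<Delta>\<close>, it moves \<open>f\<close> by at most
  \<open>\<parallel>f - P\<^sub>r f\<parallel> \<le> T \<parallel>\<Delta> f\<parallel>\<close>, where \<open>r = e^(-T)\<close> (\<open>noise_displacement\<close>).

  If \<open>f\<close> has frequencies between \<open>d\<close> and \<open>D = d + m\<close> only, then \<open>r^(-d) P\<^sub>r f\<close> is a polynomial in \<open>r\<close>
  of degree at most \<open>m\<close>.  On \<open>[d/D, 1]\<close> its norm is at most \<open>(D/d)^d \<parallel>f\<parallel> \<le> e^m \<parallel>f\<parallel>\<close>.  A polynomial of
  degree \<open>m\<close> that is bounded on an interval of length \<open>m/D\<close> grows at distance \<open>1 - r\<close> from its right
  end by at most the factor \<open>(C (1 - r) D/m)^m\<close>, which Lagrange interpolation at \<open>m + 1\<close> equally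
  spaced nodes makes explicit.  At \<open>r = e^(-T)\<close> this growth is beaten by the factor
  \<open>r^d = e^(-8m)\<close>, so \<open>\<parallel>P\<^sub>r f\<parallel> \<le> \<parallel>f\<parallel>/2\<close> (\<open>noise_extrapolation\<close>, \<open>noise_halves_norm\<close>).

  Together, \<open>\<parallel>f\<parallel> \<le> \<parallel>f - P\<^sub>r f\<parallel> + \<parallel>P\<^sub>r f\<parallel> \<le> T \<parallel>\<Delta> f\<parallel> + \<parallel>f\<parallel>/2\<close>, that is
  \<open>\<parallel>\<Delta> f\<parallel> \<ge> (1/16) (d/m) \<parallel>f\<parallel>\<close>.
\<close>

section \<open>The \<open>L\<^sub>p\<close> norm on the cube\<close>

lemma finite_cube [simp]: "finite (cube n)"
  unfolding cube_def by (intro finite_PiE) auto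

lemma cube_norm_nonneg [simp]: "0 \<le> cube_norm n p f"
  by (simp add: cube_norm_def)

lemma cube_norm_cong:
  "(\<And>\<epsilon>. \<epsilon> \<in> cube n \<Longrightarrow> f \<epsilon> = g \<epsilon>) \<Longrightarrow> cube_norm n p f = cube_norm n p g"
  unfolding cube_norm_def by (metis (no_types, lifting) sum.cong)

lemma cube_norm_le_iff:
  assumes "0 < p" "0 \<le> C"
  shows "cube_norm n p f \<le> C \<longleftrightarrow> (\<Sum>\<epsilon>\<in>cube n. norm (f \<epsilon>) powr p) \<le> 2 ^ n * C powr p"
proof -
  define M where "M = (1 / 2 ^ n) * (\<Sum>\<epsilon>\<in>cube n. norm (f \<epsilon>) powr p)"
  have M: "0 \<le> M" unfolding M_def by (intro mult_nonneg_nonneg sum_nonneg) auto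
  have "cube_norm n p f \<le> C \<longleftrightarrow> M powr (1 / p) \<le> (C powr p) powr (1 / p)"
    using assms by (simp add: cube_norm_def M_def powr_powr)
  also have "\<dots> \<longleftrightarrow> M \<le> C powr p"
    using assms M powr_less_mono2[of "1/p" "C powr p" M]
    by (auto intro: powr_mono2 simp: not_le[symmetric])
  finally show ?thesis by (simp add: M_def field_simps)
qed

lemma sum_powr_eq_cube_norm:
  assumes "0 < p"
  shows "(\<Sum>\<epsilon>\<in>cube n. norm (f \<epsilon>) powr p) = 2 ^ n * cube_norm n p f powr p"
proof -
  have "0 \<le> (\<Sum>\<epsilon>\<in>cube n. norm (f \<epsilon>) powr p)"
    by (intro sum_nonneg) auto
  then show ?thesis using assms by (simp add: cube_norm_def powr_powr)
qed

text \<open>Convexity on \<open>{0<..}\<close> is \<open>powr_convex\<close>.  A chord from the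
  endpoint \<open>0\<close> needs only \<open>s powr p \<le> s\<close> for \<open>s\<close> in \<open>{0<..<1}\<close>.\<close>
lemma convex_on_powr_nonneg:
  fixes p :: real
  assumes "1 \<le> p"
  shows "convex_on {0..} (\<lambda>x. x powr p)"
proof (rule convex_onI)
  fix t x y :: real
  assume t: "0 < t" "t < 1" and xy: "x \<in> {0..}" "y \<in> {0..}"
  have scale: "s powr p \<le> s" if "0 < s" "s < 1" for s :: real
    using that assms powr_mono'[of 1 p s] by simp
  consider "x = 0" | "y = 0" | "0 < x" "0 < y" using xy by force
  then show "((1 - t) *\<^sub>R x + t *\<^sub>R y) powr p \<le> (1 - t) * x powr p + t * y powr p"
  proof cases
    case 1
    with t xy scale[of t] show ?thesis by (simp add: powr_mult mult_right_mono)
  next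
    case 2
    with t xy scale[of "1 - t"] show ?thesis by (simp add: powr_mult mult_right_mono)
  next
    case 3
    with t show ?thesis using convex_onD[OF powr_convex[OF assms], of t x y] by simp
  qed
qed simp

lemma cube_norm_scaleR:
  assumes "0 < p"
  shows "cube_norm n p (\<lambda>\<epsilon>. c *\<^sub>R f \<epsilon>) = \<bar>c\<bar> * cube_norm n p f"
proof -
  have *: "0 \<le> (1 / 2 ^ n) * (\<Sum>\<epsilon>\<in>cube n. norm (f \<epsilon>) powr p)"
    by (intro mult_nonneg_nonneg sum_nonneg) auto
  have "cube_norm n p (\<lambda>\<epsilon>. c *\<^sub>R f \<epsilon>) =
      (\<bar>c\<bar> powr p * ((1 / 2 ^ n) * (\<Sum>\<epsilon>\<in>cube n. norm (f \<epsilon>) powr p))) powr (1 / p)"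
    by (simp add: cube_norm_def powr_mult sum_distrib_left mult_ac)
  also have "\<dots> = \<bar>c\<bar> * cube_norm n p f"
    using assms by (subst powr_mult) (simp_all add: powr_powr cube_norm_def)
  finally show ?thesis .
qed

text \<open>Minkowski's inequality from convexity of \<open>t powr p\<close>: with \<open>a\<close>, \<open>b\<close>
  upper bounds for the two norms, \<open>(f + g) / (a + b)\<close> is bounded by the convex combination of
  \<open>f / a\<close> and \<open>g / b\<close> with weights \<open>a / (a + b)\<close> and \<open>b / (a + b)\<close>, both of which lie in the unit
  ball.\<close>
lemma cube_norm_triangle:
  assumes p: "1 \<le> p"
  shows "cube_norm n p (\<lambda>\<epsilon>. f \<epsilon> + g \<epsilon>) \<le> cube_norm n p f + cube_norm n p g"
proof (rule field_le_epsilon)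
  fix e :: real assume e: "0 < e"
  \<comment> \<open>Enlarging the norms by \<open>e / 2\<close> keeps the denominators positive when a norm vanishes.\<close>
  define a where "a = cube_norm n p f + e / 2"
  define b where "b = cube_norm n p g + e / 2"
  have ab: "0 < a" "0 < b" using e by (auto simp: a_def b_def add_nonneg_pos)
  have p0: "0 < p" using p by simp
  have pt: "norm (f \<epsilon> + g \<epsilon>) powr p \<le>
      (a + b) powr p * (a / (a + b) * (norm (f \<epsilon>) powr p / a powr p)
                      + b / (a + b) * (norm (g \<epsilon>) powr p / b powr p))" for \<epsilon>
  proof -
    let ?u = "norm (f \<epsilon>) / a" and ?v = "norm (g \<epsilon>) / b"
    have t: "1 - b / (a + b) = a / (a + b)" using ab by (simp add: field_simps)
    have "norm (f \<epsilon> + g \<epsilon>) powr p \<le> (norm (f \<epsilon>) + norm (g \<epsilon>)) powr p"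
      using p by (intro powr_mono2 norm_triangle_ineq) auto
    also have "norm (f \<epsilon>) + norm (g \<epsilon>) = (a + b) * (a / (a + b) * ?u + b / (a + b) * ?v)"
    proof -
      have "(a + b) * (a / (a + b) * ?u + b / (a + b) * ?v) = a * ?u + b * ?v"
        using ab by (simp add: distrib_left)
      then show ?thesis using ab by simp
    qed
    also have "\<dots> powr p = (a + b) powr p * (a / (a + b) * ?u + b / (a + b) * ?v) powr p"
      using ab by (intro powr_mult) 
    also have "(a / (a + b) * ?u + b / (a + b) * ?v) powr p
        \<le> a / (a + b) * ?u powr p + b / (a + b) * ?v powr p"
      using convex_onD[OF convex_on_powr_nonneg[OF p], of "b / (a + b)" ?u ?v] ab
      unfolding t by simp
    finally show ?thesis using ab by (simp add: powr_divide mult_left_mono)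
  qed
  have le: "norm_sum / c powr p \<le> 2 ^ n"
    if "0 < c" "cube_norm n p h \<le> c" "norm_sum = (\<Sum>\<epsilon>\<in>cube n. norm (h \<epsilon>) powr p)"
    for c norm_sum and h :: "(nat \<Rightarrow> real) \<Rightarrow> 'a"
    using that cube_norm_le_iff[of p c n h] p0 by (simp add: field_simps)
  have "(\<Sum>\<epsilon>\<in>cube n. norm (f \<epsilon> + g \<epsilon>) powr p) \<le>
      (\<Sum>\<epsilon>\<in>cube n. (a + b) powr p * (a / (a + b) * (norm (f \<epsilon>) powr p / a powr p)
                      + b / (a + b) * (norm (g \<epsilon>) powr p / b powr p)))"
    by (intro sum_mono pt)
  also have "\<dots> = (a + b) powr p * (a / (a + b) * ((\<Sum>\<epsilon>\<in>cube n. norm (f \<epsilon>) powr p) / a powr p)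
                      + b / (a + b) * ((\<Sum>\<epsilon>\<in>cube n. norm (g \<epsilon>) powr p) / b powr p))"
    by (simp only: distrib_left sum.distrib sum_distrib_left sum_divide_distrib)
  also have "\<dots> \<le> (a + b) powr p * (a / (a + b) * 2 ^ n + b / (a + b) * 2 ^ n)"
    using ab e by (intro mult_left_mono add_mono le) (auto simp: a_def b_def)
  also have "a / (a + b) * 2 ^ n + b / (a + b) * 2 ^ n = 2 ^ n"
    using ab by (simp flip: distrib_right add_divide_distrib)
  finally have "cube_norm n p (\<lambda>\<epsilon>. f \<epsilon> + g \<epsilon>) \<le> a + b"
    using p0 ab by (subst cube_norm_le_iff) (auto simp: mult.commute)
  then show "cube_norm n p (\<lambda>\<epsilon>. f \<epsilon> + g \<epsilon>) \<le> cube_norm n p f + cube_norm n p g + e"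
    by (simp add: a_def b_def)
qed

lemma cube_norm_lincomb_le:
  assumes "1 \<le> p"
  shows "cube_norm n p (\<lambda>\<epsilon>. \<Sum>i\<in>I. c i *\<^sub>R f i \<epsilon>) \<le> (\<Sum>i\<in>I. \<bar>c i\<bar> * cube_norm n p (f i))"
proof (cases "finite I")
  case True
  then show ?thesis
  proof (induction I rule: finite_induct)
    case empty
    then show ?case using assms by (simp add: cube_norm_def)
  next
    case (insert i I)
    have "cube_norm n p (\<lambda>\<epsilon>. c i *\<^sub>R f i \<epsilon> + (\<Sum>i\<in>I. c i *\<^sub>R f i \<epsilon>))
        \<le> cube_norm n p (\<lambda>\<epsilon>. c i *\<^sub>R f i \<epsilon>) + cube_norm n p (\<lambda>\<epsilon>. \<Sum>i\<in>I. c i *\<^sub>R f i \<epsilon>)"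
      by (rule cube_norm_triangle[OF assms])
    also have "cube_norm n p (\<lambda>\<epsilon>. c i *\<^sub>R f i \<epsilon>) = \<bar>c i\<bar> * cube_norm n p (f i)"
      using assms by (intro cube_norm_scaleR) auto
    finally show ?case using insert by simp
  qed
next
  case False
  then show ?thesis using assms by (simp add: cube_norm_def)
qed

lemma tendsto_cube_norm:
  assumes p: "0 < p" and "\<And>\<epsilon>. \<epsilon> \<in> cube n \<Longrightarrow> ((\<lambda>t. f t \<epsilon>) \<longlongrightarrow> g \<epsilon>) F"
  shows "((\<lambda>t. cube_norm n p (f t)) \<longlongrightarrow> cube_norm n p g) F"
  unfolding cube_norm_def using p
  by (intro tendsto_powr2[where b = "1/p"] tendsto_mult tendsto_sum tendsto_const
        tendsto_powr2[where b = p] tendsto_norm assms)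
     (auto intro!: always_eventually divide_nonneg_nonneg sum_nonneg)

text \<open>Jensen's inequality in each row uses that rows sum to 1;
  exchanging the sums then uses that columns do.\<close>
lemma cube_norm_doubly_stochastic_le:
  assumes p: "1 \<le> p"
    and nonneg: "\<And>\<epsilon> \<delta>. \<epsilon> \<in> cube n \<Longrightarrow> \<delta> \<in> cube n \<Longrightarrow> 0 \<le> K \<epsilon> \<delta>"
    and row: "\<And>\<epsilon>. \<epsilon> \<in> cube n \<Longrightarrow> (\<Sum>\<delta>\<in>cube n. K \<epsilon> \<delta>) = 1"
    and col: "\<And>\<delta>. \<delta> \<in> cube n \<Longrightarrow> (\<Sum>\<epsilon>\<in>cube n. K \<epsilon> \<delta>) = 1"
  shows "cube_norm n p (\<lambda>\<epsilon>. \<Sum>\<delta>\<in>cube n. K \<epsilon> \<delta> *\<^sub>R f \<delta>) \<le> cube_norm n p f"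
proof -
  have p0: "0 < p" using p by simp
  have jensen: "norm (\<Sum>\<delta>\<in>cube n. K \<epsilon> \<delta> *\<^sub>R f \<delta>) powr p
      \<le> (\<Sum>\<delta>\<in>cube n. K \<epsilon> \<delta> * norm (f \<delta>) powr p)" if \<epsilon>: "\<epsilon> \<in> cube n" for \<epsilon>
  proof -
    have "norm (\<Sum>\<delta>\<in>cube n. K \<epsilon> \<delta> *\<^sub>R f \<delta>) \<le> (\<Sum>\<delta>\<in>cube n. K \<epsilon> \<delta> *\<^sub>R norm (f \<delta>))"
      using nonneg[OF \<epsilon>] by (intro sum_norm_le) auto
    then have "norm (\<Sum>\<delta>\<in>cube n. K \<epsilon> \<delta> *\<^sub>R f \<delta>) powr p
        \<le> (\<Sum>\<delta>\<in>cube n. K \<epsilon> \<delta> *\<^sub>R norm (f \<delta>)) powr p"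
      using p by (intro powr_mono2) auto
    also have "\<dots> \<le> (\<Sum>\<delta>\<in>cube n. K \<epsilon> \<delta> * norm (f \<delta>) powr p)"
      using \<epsilon> nonneg row p
      by (intro convex_on_sum[OF _ _ convex_on_powr_nonneg]) auto
    finally show ?thesis .
  qed
  have "(\<Sum>\<epsilon>\<in>cube n. norm (\<Sum>\<delta>\<in>cube n. K \<epsilon> \<delta> *\<^sub>R f \<delta>) powr p)
      \<le> (\<Sum>\<epsilon>\<in>cube n. \<Sum>\<delta>\<in>cube n. K \<epsilon> \<delta> * norm (f \<delta>) powr p)"
    by (intro sum_mono jensen)
  also have "\<dots> = (\<Sum>\<delta>\<in>cube n. (\<Sum>\<epsilon>\<in>cube n. K \<epsilon> \<delta>) * norm (f \<delta>) powr p)"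
    by (subst sum.swap) (simp add: sum_distrib_right)
  also have "\<dots> = 2 ^ n * cube_norm n p f powr p"
    using p0 by (simp add: col flip: sum_powr_eq_cube_norm)
  finally show ?thesis using p0 by (simp add: cube_norm_le_iff)
qed

section \<open>Noise operators and the Walsh expansion\<close>

lemma sum_cube_prod:
  fixes g :: "nat \<Rightarrow> real \<Rightarrow> real"
  shows "(\<Sum>\<delta>\<in>cube n. \<Prod>i\<in>{1..n}. g i (\<delta> i)) = (\<Prod>i\<in>{1..n}. g i (-1) + g i 1)"
  unfolding cube_def by (subst prod_sum_PiE[symmetric]) auto

definition walsh_sum ::
    "nat \<Rightarrow> (nat set \<Rightarrow> 'a::real_normed_vector) \<Rightarrow> (nat \<Rightarrow> real) \<Rightarrow> 'a" where
  "walsh_sum n x \<epsilon> = (\<Sum>A\<in>Pow {1..n}. walsh A \<epsilon> *\<^sub>R x A)"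

text \<open>A Riesz product in \<open>\<delta>\<close>: for \<open>0 \<le> \<rho> \<le> 1\<close> and \<open>\<epsilon>\<close> in the cube, the probability of
  \<open>\<delta>\<close> when its coordinates are independent signs with means \<open>\<rho> * \<epsilon> i\<close>.\<close>
definition noise_kernel :: "nat \<Rightarrow> real \<Rightarrow> (nat \<Rightarrow> real) \<Rightarrow> (nat \<Rightarrow> real) \<Rightarrow> real" where
  "noise_kernel n \<rho> \<epsilon> \<delta> = (\<Prod>i\<in>{1..n}. 1 + \<rho> * \<epsilon> i * \<delta> i) / 2 ^ n"

text \<open>The kernel is a product over the coordinates, so the sum over the
  cube factorises; a coordinate contributes \<open>\<rho> * \<epsilon> i\<close> if it lies in \<open>A\<close> and 1 otherwise.  Hence
  averaging against the kernel multiplies each Walsh function by a power of \<open>\<rho>\<close>.\<close>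
lemma sum_noise_kernel_walsh:
  assumes "A \<subseteq> {1..n}"
  shows "(\<Sum>\<delta>\<in>cube n. noise_kernel n \<rho> \<epsilon> \<delta> * walsh A \<delta>) = \<rho> ^ card A * walsh A \<epsilon>"
proof -
  have restrict: "(\<Prod>i\<in>A. h i) = (\<Prod>i\<in>{1..n}. if i \<in> A then h i else 1)" for h :: "nat \<Rightarrow> real"
    using assms by (simp add: prod.inter_restrict[symmetric] Int_absorb1)
  have "(\<Sum>\<delta>\<in>cube n. noise_kernel n \<rho> \<epsilon> \<delta> * walsh A \<delta>)
      = (\<Sum>\<delta>\<in>cube n. \<Prod>i\<in>{1..n}. (1 + \<rho> * \<epsilon> i * \<delta> i) * (if i \<in> A then \<delta> i else 1)) / 2 ^ n"
    by (simp add: noise_kernel_def walsh_def restrict prod.distrib sum_divide_distrib)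
  also have "\<dots> = (\<Prod>i\<in>{1..n}. (1 + \<rho> * \<epsilon> i * (-1)) * (if i \<in> A then -1 else 1)
                    + (1 + \<rho> * \<epsilon> i * 1) * (if i \<in> A then 1 else 1)) / 2 ^ n"
    by (subst sum_cube_prod) simp
  also have "\<dots> = (\<Prod>i\<in>{1..n}. 2 * (if i \<in> A then \<rho> * \<epsilon> i else 1)) / 2 ^ n"
    by (intro arg_cong2[where f = "(/)"] prod.cong) auto
  also have "\<dots> = (\<Prod>i\<in>A. \<rho> * \<epsilon> i)"
    unfolding restrict by (subst prod.distrib) simp
  also have "\<dots> = \<rho> ^ card A * walsh A \<epsilon>"
    by (simp add: prod.distrib walsh_def)
  finally show ?thesis .
qed

lemma noise_kernel_nonneg:
  assumes "0 \<le> \<rho>" "\<rho> \<le> 1" "\<epsilon> \<in> cube n" "\<delta> \<in> cube n"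
  shows "0 \<le> noise_kernel n \<rho> \<epsilon> \<delta>"
proof -
  have "0 \<le> 1 + \<rho> * \<epsilon> i * \<delta> i" if "i \<in> {1..n}" for i
  proof -
    have "\<epsilon> i \<in> {-1, 1}" "\<delta> i \<in> {-1, 1}"
      using assms that unfolding cube_def by (auto dest!: PiE_mem)
    then show ?thesis using assms by auto
  qed
  then show ?thesis unfolding noise_kernel_def by (intro divide_nonneg_nonneg prod_nonneg) auto
qed

lemma noise_kernel_commute: "noise_kernel n \<rho> \<epsilon> \<delta> = noise_kernel n \<rho> \<delta> \<epsilon>"
  by (simp add: noise_kernel_def mult_ac)

text \<open>For \<open>0 \<le> \<rho> \<le> 1\<close> the kernel is nonnegative, and its rows and, by
  symmetry, its columns sum to 1 (the Walsh function of the empty set is constant).\<close>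
lemma noise_contraction:
  assumes "1 \<le> p" "0 \<le> \<rho>" "\<rho> \<le> 1"
  shows "cube_norm n p (walsh_sum n (\<lambda>A. \<rho> ^ card A *\<^sub>R x A)) \<le> cube_norm n p (walsh_sum n x)"
proof -
  have row: "(\<Sum>\<delta>\<in>cube n. noise_kernel n \<rho> \<epsilon> \<delta>) = 1" for \<epsilon>
    using sum_noise_kernel_walsh[of "{}" n \<rho> \<epsilon>] by (simp add: walsh_def)
  then have col: "(\<Sum>\<epsilon>\<in>cube n. noise_kernel n \<rho> \<epsilon> \<delta>) = 1" for \<delta>
    by (subst noise_kernel_commute)
  have "walsh_sum n (\<lambda>A. \<rho> ^ card A *\<^sub>R x A) \<epsilon>
      = (\<Sum>\<delta>\<in>cube n. noise_kernel n \<rho> \<epsilon> \<delta> *\<^sub>R walsh_sum n x \<delta>)" for \<epsilon>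
  proof -
    have "(\<Sum>\<delta>\<in>cube n. noise_kernel n \<rho> \<epsilon> \<delta> *\<^sub>R walsh_sum n x \<delta>)
        = (\<Sum>A\<in>Pow {1..n}. (\<Sum>\<delta>\<in>cube n. noise_kernel n \<rho> \<epsilon> \<delta> * walsh A \<delta>) *\<^sub>R x A)"
      unfolding walsh_sum_def scaleR_sum_right by (subst sum.swap) (simp add: scaleR_sum_left)
    also have "\<dots> = walsh_sum n (\<lambda>A. \<rho> ^ card A *\<^sub>R x A) \<epsilon>"
      unfolding walsh_sum_def
      by (intro sum.cong refl, subst sum_noise_kernel_walsh) (auto simp: mult.commute)
    finally show ?thesis by simp
  qed
  then have "walsh_sum n (\<lambda>A. \<rho> ^ card A *\<^sub>R x A)
      = (\<lambda>\<epsilon>. \<Sum>\<delta>\<in>cube n. noise_kernel n \<rho> \<epsilon> \<delta> *\<^sub>R walsh_sum n x \<delta>)"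
    by (rule ext)
  then show ?thesis
    using assms row col by (simp add: cube_norm_doubly_stochastic_le noise_kernel_nonneg)
qed

lemma noise_kernel_one:
  assumes "\<epsilon> \<in> cube n" "\<delta> \<in> cube n"
  shows "noise_kernel n 1 \<epsilon> \<delta> = (if \<epsilon> = \<delta> then 1 else 0)"
proof (cases "\<epsilon> = \<delta>")
  case True
  have "1 + 1 * \<epsilon> i * \<delta> i = 2" if "i \<in> {1..n}" for i
    using assms that True unfolding cube_def by (auto dest!: PiE_mem)
  then have "(\<Prod>i\<in>{1..n}. 1 + 1 * \<epsilon> i * \<delta> i) = (\<Prod>i\<in>{1..n}. 2)"
    by (intro prod.cong) auto
  then show ?thesis using True by (simp add: noise_kernel_def)
next
  case False
  then obtain i where i: "i \<in> {1..n}" "\<epsilon> i \<noteq> \<delta> i"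
    using assms unfolding cube_def by (metis PiE_ext)
  have "\<epsilon> i \<in> {-1, 1}" "\<delta> i \<in> {-1, 1}"
    using assms i(1) unfolding cube_def by (auto dest!: PiE_mem)
  with i(2) have "1 + 1 * \<epsilon> i * \<delta> i = 0" by auto
  then have "(\<Prod>i\<in>{1..n}. 1 + 1 * \<epsilon> i * \<delta> i) = 0"
    using i(1) by (intro prod_zero) auto
  then show ?thesis using False by (simp add: noise_kernel_def)
qed

text \<open>The kernel with \<open>\<rho> = 1\<close> is the identity matrix, and expanding its defining
  product over the subsets of coordinates turns it into the Walsh expansion.\<close>
lemma walsh_expansion:
  assumes "\<epsilon> \<in> cube n"
  shows "walsh_sum n (walsh_coeff n f) \<epsilon> = f \<epsilon>"
proof -
  have "noise_kernel n 1 \<epsilon> \<delta> = (\<Sum>A\<in>Pow {1..n}. walsh A \<epsilon> * (1 / 2 ^ n * walsh A \<delta>))" for \<delta>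
    unfolding noise_kernel_def walsh_def
    by (subst add.commute, subst prod_add) (simp_all add: prod.distrib sum_divide_distrib)
  then have "(\<Sum>\<delta>\<in>cube n. noise_kernel n 1 \<epsilon> \<delta> *\<^sub>R f \<delta>) = walsh_sum n (walsh_coeff n f) \<epsilon>"
    unfolding walsh_sum_def walsh_coeff_def scaleR_sum_right
    by (simp add: scaleR_sum_left) (rule sum.swap)
  moreover have "(\<Sum>\<delta>\<in>cube n. noise_kernel n 1 \<epsilon> \<delta> *\<^sub>R f \<delta>) = (\<Sum>\<delta>\<in>cube n. if \<delta> = \<epsilon> then f \<delta> else 0)"
    using assms by (intro sum.cong) (auto simp: noise_kernel_one)
  ultimately show ?thesis using assms by simp
qed

section \<open>Displacement under noise\<close>

lemma walsh_sum_add: "walsh_sum n (\<lambda>A. x A + y A) \<epsilon> = walsh_sum n x \<epsilon> + walsh_sum n y \<epsilon>"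
  by (simp add: walsh_sum_def scaleR_right_distrib sum.distrib)

lemma walsh_sum_scaleR: "walsh_sum n (\<lambda>A. c *\<^sub>R x A) \<epsilon> = c *\<^sub>R walsh_sum n x \<epsilon>"
  by (simp add: walsh_sum_def scaleR_sum_right mult_ac)

lemma cube_norm_walsh_sum_triangle:
  "1 \<le> p \<Longrightarrow> cube_norm n p (walsh_sum n (\<lambda>A. x A + y A))
      \<le> cube_norm n p (walsh_sum n x) + cube_norm n p (walsh_sum n y)"
  using cube_norm_triangle[of p n "walsh_sum n x" "walsh_sum n y"]
  by (simp flip: walsh_sum_add)

lemma cube_norm_walsh_sum_scaleR:
  "0 < p \<Longrightarrow> cube_norm n p (walsh_sum n (\<lambda>A. c *\<^sub>R x A)) = \<bar>c\<bar> * cube_norm n p (walsh_sum n x)"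
  using cube_norm_scaleR[of p n c "walsh_sum n x"] by (simp flip: walsh_sum_scaleR)

text \<open>The displacement caused by \<open>N\<close> contractive steps telescopes into
  \<open>N\<close> single-step displacements, each damped by the noise applied before it.\<close>
lemma noise_power_displacement:
  assumes p: "1 \<le> p" and \<rho>: "0 \<le> \<rho>" "\<rho> \<le> 1"
  shows "cube_norm n p (walsh_sum n (\<lambda>A. (1 - (\<rho> ^ N) ^ card A) *\<^sub>R x A))
      \<le> real N * cube_norm n p (walsh_sum n (\<lambda>A. (1 - \<rho> ^ card A) *\<^sub>R x A))"
proof (induction N)
  case 0
  then show ?case using p by (simp add: cube_norm_def walsh_sum_def)
next
  case (Suc N)
  have "(1 - (\<rho> ^ Suc N) ^ card A) *\<^sub>R x A
      = (1 - (\<rho> ^ N) ^ card A) *\<^sub>R x A + (\<rho> ^ N) ^ card A *\<^sub>R (1 - \<rho> ^ card A) *\<^sub>R x A" for A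
  proof -
    have "(\<rho> ^ Suc N) ^ card A = (\<rho> ^ N) ^ card A * \<rho> ^ card A"
      by (simp only: power_Suc power_mult_distrib mult.commute)
    then show ?thesis by (simp only: scaleR_scaleR right_diff_distrib flip: scaleR_left_distrib) simp
  qed
  then have "cube_norm n p (walsh_sum n (\<lambda>A. (1 - (\<rho> ^ Suc N) ^ card A) *\<^sub>R x A))
      = cube_norm n p (walsh_sum n (\<lambda>A. (1 - (\<rho> ^ N) ^ card A) *\<^sub>R x A
          + (\<rho> ^ N) ^ card A *\<^sub>R (1 - \<rho> ^ card A) *\<^sub>R x A))"
    by simp
  also have "\<dots> \<le> cube_norm n p (walsh_sum n (\<lambda>A. (1 - (\<rho> ^ N) ^ card A) *\<^sub>R x A))
        + cube_norm n p (walsh_sum n (\<lambda>A. (\<rho> ^ N) ^ card A *\<^sub>R (1 - \<rho> ^ card A) *\<^sub>R x A))"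
    by (rule cube_norm_walsh_sum_triangle[OF p])
  also have "cube_norm n p (walsh_sum n (\<lambda>A. (\<rho> ^ N) ^ card A *\<^sub>R (1 - \<rho> ^ card A) *\<^sub>R x A))
      \<le> cube_norm n p (walsh_sum n (\<lambda>A. (1 - \<rho> ^ card A) *\<^sub>R x A))"
    using \<rho> by (intro noise_contraction p) (auto intro: power_le_one)
  finally show ?case using Suc by (simp add: algebra_simps)
qed

lemma tendsto_scaled_one_minus_exp:
  "(\<lambda>N. real N * (1 - exp (- (a / real N)))) \<longlonglongrightarrow> a"
proof -
  have "((\<lambda>h. 1 - exp (- (a * h))) has_real_derivative a) (at 0)"
    by (auto intro!: derivative_eq_intros)
  then have "((\<lambda>h. (1 - exp (- (a * h))) / h) \<longlongrightarrow> a) (at 0)"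
    by (simp add: has_field_derivative_iff)
  moreover have "filterlim (\<lambda>N. inverse (real N)) (at 0) sequentially"
    unfolding filterlim_at
    by (auto intro!: tendsto_inverse_0_at_top filterlim_real_sequentially
          eventually_mono[OF eventually_gt_at_top[of 0]])
  ultimately have "(\<lambda>N. (1 - exp (- (a * inverse (real N)))) / inverse (real N)) \<longlonglongrightarrow> a"
    by (rule filterlim_compose)
  then show ?thesis by (simp add: divide_inverse mult.commute)
qed

text \<open>Splitting the time \<open>T\<close> into \<open>N\<close> equal steps bounds the displacement by
  \<open>N\<close> times that of one step, which tends to \<open>T\<close> times the generator as \<open>N\<close> tends to infinity.\<close>
lemma noise_displacement:
  assumes p: "1 \<le> p" and T: "0 \<le> T"
  shows "cube_norm n p (walsh_sum n (\<lambda>A. (1 - exp (- T) ^ card A) *\<^sub>R x A))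
      \<le> T * cube_norm n p (walsh_sum n (\<lambda>A. real (card A) *\<^sub>R x A))"
proof -
  let ?c = "\<lambda>N k. real N * (1 - exp (- (T / real N)) ^ k)"
  have lim: "(\<lambda>N. ?c N k) \<longlonglongrightarrow> T * real k" for k
    using tendsto_scaled_one_minus_exp[of "T * real k"]
    by (simp add: mult.commute flip: exp_of_nat_mult)
  have "(\<lambda>N. cube_norm n p (walsh_sum n (\<lambda>A. ?c N (card A) *\<^sub>R x A)))
      \<longlonglongrightarrow> cube_norm n p (walsh_sum n (\<lambda>A. (T * real (card A)) *\<^sub>R x A))"
    unfolding walsh_sum_def
    using p by (intro tendsto_cube_norm tendsto_sum tendsto_scaleR tendsto_const lim) simp
  moreover have "cube_norm n p (walsh_sum n (\<lambda>A. (1 - exp (- T) ^ card A) *\<^sub>R x A))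
      \<le> cube_norm n p (walsh_sum n (\<lambda>A. ?c N (card A) *\<^sub>R x A))" if "1 \<le> N" for N
  proof -
    let ?\<rho> = "exp (- (T / real N))"
    have "?\<rho> ^ N = exp (- T)" using that by (simp flip: exp_of_nat_mult)
    then have "cube_norm n p (walsh_sum n (\<lambda>A. (1 - exp (- T) ^ card A) *\<^sub>R x A))
        \<le> real N * cube_norm n p (walsh_sum n (\<lambda>A. (1 - ?\<rho> ^ card A) *\<^sub>R x A))"
      using noise_power_displacement[OF p, of ?\<rho> n N x] T by simp
    also have "\<dots> = cube_norm n p (walsh_sum n (\<lambda>A. ?c N (card A) *\<^sub>R x A))"
      using p cube_norm_walsh_sum_scaleR[of p n "real N" "\<lambda>A. (1 - ?\<rho> ^ card A) *\<^sub>R x A"] by simp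
    finally show ?thesis .
  qed
  ultimately have "cube_norm n p (walsh_sum n (\<lambda>A. (1 - exp (- T) ^ card A) *\<^sub>R x A))
      \<le> cube_norm n p (walsh_sum n (\<lambda>A. (T * real (card A)) *\<^sub>R x A))"
    by (intro LIMSEQ_le_const) auto
  also have "\<dots> = T * cube_norm n p (walsh_sum n (\<lambda>A. real (card A) *\<^sub>R x A))"
    using p T cube_norm_walsh_sum_scaleR[of p n T "\<lambda>A. real (card A) *\<^sub>R x A"] by simp
  finally show ?thesis .
qed

section \<open>Lagrange interpolation at equally spaced nodes\<close>

text \<open>The nodes are \<open>0, 1, \<dots>, m\<close>; other equally spaced nodes are reached by an
  affine substitution in the polynomial.\<close>
definition lagrange_basis :: "nat \<Rightarrow> nat \<Rightarrow> real \<Rightarrow> real" where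
  "lagrange_basis m i x = (\<Prod>j\<in>{..m} - {i}. (x - real j) / (real i - real j))"

lemma lagrange_interpolation:
  fixes q :: "real poly"
  assumes "degree q \<le> m"
  shows "poly q x = (\<Sum>i\<le>m. lagrange_basis m i x * poly q (real i))"
proof -
  define L where "L i = (\<Prod>j\<in>{..m} - {i}. smult (1 / (real i - real j)) [:- real j, 1:])" for i
  define r where "r = (\<Sum>i\<le>m. smult (poly q (real i)) (L i))"
  have L: "poly (L i) y = lagrange_basis m i y" for i y
    unfolding L_def lagrange_basis_def poly_prod by (intro prod.cong) (auto simp: diff_divide_distrib)
  have deg: "degree (L i) \<le> m" if "i \<le> m" for i
  proof -
    have "degree (L i) \<le> (\<Sum>j\<in>{..m} - {i}. degree (smult (1 / (real i - real j)) [:- real j, 1:]))"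
      unfolding L_def by (rule order.trans[OF degree_prod_sum_le]) (auto simp: o_def)
    also have "\<dots> \<le> (\<Sum>j\<in>{..m} - {i}. 1)"
      by (intro sum_mono) simp
    finally show ?thesis using that by simp
  qed
  have node: "lagrange_basis m i (real k) = (if i = k then 1 else 0)" if "k \<le> m" for i k
    unfolding lagrange_basis_def using that by (auto intro!: prod.neutral)
  have "q = r"
  proof (rule poly_eqI_degree[where A = "real ` {..m}"])
    show "poly q y = poly r y" if "y \<in> real ` {..m}" for y
    proof -
      from that obtain k where k: "k \<le> m" "y = real k" by auto
      from k have "poly r y = (\<Sum>i\<le>m. if i = k then poly q (real i) else 0)"
        unfolding r_def poly_sum by (intro sum.cong) (auto simp: L node)
      then show ?thesis using k by simp
    qed
    have "card (real ` {..m}) = m + 1" by (subst card_image) auto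
    moreover have "degree r \<le> m"
      unfolding r_def by (intro degree_sum_le) (auto simp: deg)
    ultimately show "degree q < card (real ` {..m})" "degree r < card (real ` {..m})"
      using assms by auto
  qed
  then have "poly q x = poly r x" by simp
  then show ?thesis by (simp add: r_def poly_sum L mult.commute)
qed

lemma prod_abs_diff_eq_fact:
  assumes "i \<le> m"
  shows "(\<Prod>j\<in>{..m} - {i}. \<bar>real i - real j\<bar>) = fact i * fact (m - i)"
proof -
  have "{..m} - {i} = {..<i} \<union> {i<..m}" using assms by auto
  then have "(\<Prod>j\<in>{..m} - {i}. \<bar>real i - real j\<bar>)
      = (\<Prod>j\<in>{..<i}. \<bar>real i - real j\<bar>) * (\<Prod>j\<in>{i<..m}. \<bar>real i - real j\<bar>)"
    by (simp add: prod.union_disjoint disjoint_iff)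
  also have "(\<Prod>j\<in>{..<i}. \<bar>real i - real j\<bar>) = (\<Prod>j\<in>{1..i}. real j)"
    by (rule prod.reindex_bij_witness[of _ "\<lambda>j. i - j" "\<lambda>j. i - j"]) auto
  also have "(\<Prod>j\<in>{i<..m}. \<bar>real i - real j\<bar>) = (\<Prod>j\<in>{1..m - i}. real j)"
    by (rule prod.reindex_bij_witness[of _ "\<lambda>j. j + i" "\<lambda>j. j - i"]) auto
  finally show ?thesis by (simp add: fact_prod)
qed

text \<open>No node exceeds \<open>x\<close>, so every numerator is at most \<open>x ^ m\<close>, and the
  reciprocals of the denominators are \<open>(m choose i) / fact m\<close> up to sign.  This bounds the growth
  of a polynomial of degree \<open>m\<close> outside the interval of its nodes.\<close>
lemma lagrange_basis_abs_sum_le: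
  assumes x: "real m \<le> x"
  shows "(\<Sum>i\<le>m. \<bar>lagrange_basis m i x\<bar>) \<le> (2 * x) ^ m / fact m"
proof -
  have "\<bar>lagrange_basis m i x\<bar> \<le> x ^ m / fact m * real (m choose i)" if i: "i \<le> m" for i
  proof -
    have "(\<Prod>j\<in>{..m} - {i}. \<bar>x - real j\<bar>) \<le> (\<Prod>j\<in>{..m} - {i}. x)"
      using x by (intro prod_mono) auto
    also have "\<dots> = x ^ m" using i by simp
    finally have "\<bar>lagrange_basis m i x\<bar> \<le> x ^ m / (fact i * fact (m - i))"
      using i by (simp add: lagrange_basis_def abs_prod prod_dividef prod_abs_diff_eq_fact divide_right_mono)
    also have "\<dots> = x ^ m / fact m * real (m choose i)"
      using i by (simp add: binomial_fact)
    finally show ?thesis .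
  qed
  then have "(\<Sum>i\<le>m. \<bar>lagrange_basis m i x\<bar>) \<le> (\<Sum>i\<le>m. x ^ m / fact m * real (m choose i))"
    by (intro sum_mono) auto
  also have "\<dots> = x ^ m / fact m * real (\<Sum>i\<le>m. m choose i)"
    by (simp add: sum_distrib_left)
  finally show ?thesis by (simp add: choose_row_sum power_mult_distrib mult_ac)
qed

text \<open>One term of the exponential series of \<open>exp m\<close>.\<close>
lemma power_self_le_exp_fact: "real m ^ m \<le> exp (real m) * fact m"
proof -
  have "(\<Sum>k\<in>{m}. real m ^ k /\<^sub>R fact k) \<le> (\<Sum>k. real m ^ k /\<^sub>R fact k)"
    by (rule sum_le_suminf[OF summable_exp_generic]) auto
  then show ?thesis by (simp add: exp_def field_simps)
qed

section \<open>Decay under noise for frequencies in an interval\<close>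

text \<open>For frequencies in \<open>[d, d + m]\<close>, the noise operator at a small \<open>r\<close> is
  a combination of noise operators at \<open>m + 1\<close> nodes in \<open>[d / (d + m), 1]\<close>, obtained by interpolating
  the polynomials \<open>r ^ (k - d)\<close> of degree at most \<open>m\<close>.  The operators at the nodes are contractions,
  so the norm is at most the absolute sum of the coefficients.  The condition on \<open>r\<close> says that
  no node lies to its left.\<close>
lemma noise_extrapolation:
  assumes p: "1 \<le> p" and d: "1 \<le> d" and m: "1 \<le> m"
    and supp: "\<And>A. A \<subseteq> {1..n} \<Longrightarrow> x A \<noteq> 0 \<Longrightarrow> d \<le> card A \<and> card A \<le> d + m"
    and r: "0 \<le> r" "r \<le> real d / real (d + m)"
  shows "cube_norm n p (walsh_sum n (\<lambda>A. r ^ card A *\<^sub>R x A))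
      \<le> r ^ d * (2 * exp 2 * (real (d + m) * (1 - r) / real m)) ^ m * cube_norm n p (walsh_sum n x)"
proof -
  define D where "D = real (d + m)"
  define X where "X = D * (1 - r)"
  \<comment> \<open>\<open>X\<close> is the position of \<open>r\<close> in the coordinate in which \<open>node i\<close> sits at \<open>i\<close>.\<close>
  define node where "node i = 1 - real i / D" for i
  define c where "c i = lagrange_basis m i X * (r / node i) ^ d" for i
  have D: "0 < D" "D = real d + real m" using d by (auto simp: D_def)
  have X: "real m \<le> X" using r D by (simp add: X_def D_def[symmetric] field_simps)
  have node: "real d / D \<le> node i" "0 < node i" "node i \<le> 1" if "i \<le> m" for i
  proof -
    have "real i / D \<le> real m / D" using that D by (intro divide_right_mono) auto
    moreover have "1 - real m / D = real d / D" using D by (simp add: field_simps)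
    ultimately show "real d / D \<le> node i" by (simp add: node_def)
    moreover have "0 < real d / D" using D d by simp
    ultimately show "0 < node i" by linarith
    show "node i \<le> 1" using D by (simp add: node_def)
  qed
  have interp: "r ^ k = (\<Sum>i\<le>m. c i * node i ^ k)" if k: "d \<le> k" "k \<le> d + m" for k
  proof -
    let ?q = "[:1, - 1 / D:] ^ (k - d)"
    have q: "poly ?q y = (1 - y / D) ^ (k - d)" for y by simp
    have "degree ?q \<le> m"
      using k by (intro order.trans[OF degree_power_le]) auto
    then have "poly ?q X = (\<Sum>i\<le>m. lagrange_basis m i X * poly ?q (real i))"
      by (rule lagrange_interpolation)
    moreover have "1 - X / D = r" using D by (simp add: X_def)
    ultimately have "r ^ (k - d) = (\<Sum>i\<le>m. lagrange_basis m i X * node i ^ (k - d))"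
      unfolding q by (simp add: node_def)
    then have "r ^ d * r ^ (k - d) = (\<Sum>i\<le>m. c i * (node i ^ d * node i ^ (k - d)))"
      using node by (auto simp: c_def sum_distrib_left power_divide less_imp_neq[THEN not_sym]
          intro!: sum.cong)
    then show ?thesis using k by (simp flip: power_add)
  qed
  \<comment> \<open>The weight \<open>(r / node i) ^ d\<close> is worst at the last node \<open>d / D\<close>, and \<open>(D / d) ^ d \<le> exp m\<close>.\<close>
  have c_le: "\<bar>c i\<bar> \<le> \<bar>lagrange_basis m i X\<bar> * (r ^ d * exp (real m))" if i: "i \<le> m" for i
  proof -
    have "r / node i \<le> r / (real d / D)"
      using r d D node[OF i] by (intro divide_left_mono) auto
    also have "\<dots> = r * (1 + real m / real d)"
      using d D by (simp add: field_simps)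
    also have "\<dots> \<le> r * exp (real m / real d)"
      using r by (intro mult_left_mono exp_ge_add_one_self)
    finally have "(r / node i) ^ d \<le> (r * exp (real m / real d)) ^ d"
      using r node[OF i] by (intro power_mono) auto
    also have "\<dots> = r ^ d * exp (real m)"
      using d by (simp add: power_mult_distrib flip: exp_of_nat_mult)
    finally show ?thesis
      using r node[OF i] by (simp add: c_def abs_mult mult_left_mono)
  qed
  have "(\<Sum>i\<le>m. \<bar>c i\<bar>) \<le> (\<Sum>i\<le>m. \<bar>lagrange_basis m i X\<bar>) * (r ^ d * exp (real m))"
    unfolding sum_distrib_right by (intro sum_mono c_le) simp
  also have "\<dots> \<le> (2 * X) ^ m / fact m * (r ^ d * exp (real m))"
    using X r by (intro mult_right_mono lagrange_basis_abs_sum_le) auto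
  also have "\<dots> \<le> (2 * X) ^ m * (exp (real m) / real m ^ m) * (r ^ d * exp (real m))"
  proof -
    have "1 / fact m \<le> exp (real m) / real m ^ m"
      using power_self_le_exp_fact[of m] m by (simp add: field_simps)
    then have "(2 * X) ^ m * (1 / fact m) \<le> (2 * X) ^ m * (exp (real m) / real m ^ m)"
      using X by (intro mult_left_mono) auto
    then show ?thesis using r by (intro mult_right_mono) auto
  qed
  also have "\<dots> = r ^ d * (2 * exp 2 * (X / real m)) ^ m"
  proof -
    have "exp (2::real) ^ m = exp (real m) * exp (real m)"
      by (simp flip: exp_of_nat_mult exp_add)
    then show ?thesis by (simp add: power_mult_distrib power_divide)
  qed
  finally have sum_c: "(\<Sum>i\<le>m. \<bar>c i\<bar>) \<le> r ^ d * (2 * exp 2 * (X / real m)) ^ m" .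

  have "walsh_sum n (\<lambda>A. r ^ card A *\<^sub>R x A) \<epsilon>
      = (\<Sum>i\<le>m. c i *\<^sub>R walsh_sum n (\<lambda>A. node i ^ card A *\<^sub>R x A) \<epsilon>)" for \<epsilon>
  proof -
    have "r ^ card A *\<^sub>R x A = (\<Sum>i\<le>m. c i *\<^sub>R node i ^ card A *\<^sub>R x A)" if "A \<in> Pow {1..n}" for A
    proof (cases "x A = 0")
      case False
      then show ?thesis
        using supp[of A] that interp[of "card A"] by (simp add: scaleR_sum_left)
    qed simp
    then have "walsh_sum n (\<lambda>A. r ^ card A *\<^sub>R x A) \<epsilon>
        = walsh_sum n (\<lambda>A. \<Sum>i\<le>m. c i *\<^sub>R node i ^ card A *\<^sub>R x A) \<epsilon>"
      unfolding walsh_sum_def by (intro sum.cong) auto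
    also have "\<dots> = (\<Sum>i\<le>m. c i *\<^sub>R walsh_sum n (\<lambda>A. node i ^ card A *\<^sub>R x A) \<epsilon>)"
      unfolding walsh_sum_def scaleR_sum_right
      by (subst sum.swap) (simp add: mult_ac)
    finally show ?thesis .
  qed
  then have "walsh_sum n (\<lambda>A. r ^ card A *\<^sub>R x A)
      = (\<lambda>\<epsilon>. \<Sum>i\<le>m. c i *\<^sub>R walsh_sum n (\<lambda>A. node i ^ card A *\<^sub>R x A) \<epsilon>)"
    by (rule ext)
  then have "cube_norm n p (walsh_sum n (\<lambda>A. r ^ card A *\<^sub>R x A))
      \<le> (\<Sum>i\<le>m. \<bar>c i\<bar> * cube_norm n p (walsh_sum n (\<lambda>A. node i ^ card A *\<^sub>R x A)))"
    using cube_norm_lincomb_le[OF p] by simp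
  also have "\<dots> \<le> (\<Sum>i\<le>m. \<bar>c i\<bar> * cube_norm n p (walsh_sum n x))"
    using node by (intro sum_mono mult_left_mono noise_contraction p) (auto intro: less_imp_le)
  also have "\<dots> \<le> r ^ d * (2 * exp 2 * (X / real m)) ^ m * cube_norm n p (walsh_sum n x)"
    unfolding sum_distrib_right[symmetric] by (intro mult_right_mono sum_c) simp
  finally show ?thesis by (simp add: X_def D_def)
qed

text \<open>At \<open>r = exp (- 8 m / d)\<close> the factor \<open>r ^ d = exp (- 8 m)\<close> wins against
  the growth of the extrapolation: \<open>(d + m) (1 - r) / m \<le> 9\<close> because \<open>1 - r\<close> is at most 1 and at most
  \<open>8 m / d\<close>, so the bound is \<open>(18 exp (-6)) ^ m\<close>, and \<open>exp 6 \<ge> 2 ^ 6\<close>.  The constant 8 is an integer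
  large enough for these crude estimates.\<close>
lemma noise_halves_norm:
  assumes p: "1 \<le> p" and d: "1 \<le> d" and m: "1 \<le> m"
    and supp: "\<And>A. A \<subseteq> {1..n} \<Longrightarrow> x A \<noteq> 0 \<Longrightarrow> d \<le> card A \<and> card A \<le> d + m"
  shows "cube_norm n p (walsh_sum n (\<lambda>A. exp (- (8 * real m / real d)) ^ card A *\<^sub>R x A))
      \<le> 1 / 2 * cube_norm n p (walsh_sum n x)"
proof -
  define y where "y = real m / real d"
  define r where "r = exp (- (8 * y))"
  have y: "0 < y" using d m by (simp add: y_def)
  have "r \<le> 1 / (1 + y)"
  proof -
    have "1 + y \<le> exp (8 * y)"
      using exp_ge_add_one_self[of "8 * y"] y by linarith
    then show ?thesis using y by (simp add: r_def exp_minus field_simps)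
  qed
  also have "1 / (1 + y) = real d / real (d + m)"
    using d by (simp add: y_def field_simps)
  finally have r_le: "r \<le> real d / real (d + m)" .
  have r_pow: "r ^ d = exp (- 8) ^ m"
    using d by (simp add: r_def y_def flip: exp_of_nat_mult)
  have "real (d + m) * (1 - r) / real m = (1 - r) / y + (1 - r)"
    using d m by (simp add: y_def field_simps)
  also have "\<dots> \<le> 8 + 1"
  proof (rule add_mono)
    have "1 - r \<le> 8 * y"
      using exp_ge_add_one_self[of "- (8 * y)"] by (simp add: r_def)
    then show "(1 - r) / y \<le> 8" using y by (simp add: field_simps)
  qed (simp add: r_def)
  finally have dist: "real (d + m) * (1 - r) / real m \<le> 9" by simp
  have "r \<le> 1" using y by (simp add: r_def)
  have "r ^ d * (2 * exp 2 * (real (d + m) * (1 - r) / real m)) ^ m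
      \<le> exp (- 8) ^ m * (2 * exp 2 * 9) ^ m"
    unfolding r_pow using \<open>r \<le> 1\<close> dist by (intro mult_left_mono power_mono) auto
  also have "\<dots> = (18 * exp (- 6)) ^ m"
  proof -
    have "exp (- 8) * exp 2 = exp (- 6 :: real)" by (simp flip: exp_add)
    then have "exp (- 8) * (2 * exp 2 * 9) = 18 * exp (- 6 :: real)" by simp
    then show ?thesis by (simp only: flip: power_mult_distrib)
  qed
  also have "\<dots> \<le> (1 / 2) ^ m"
  proof -
    have "(2::real) ^ 6 \<le> exp 1 ^ 6"
      using exp_ge_add_one_self[of 1] by (intro power_mono) auto
    then have "64 \<le> exp (6::real)" by (simp flip: exp_of_nat_mult)
    then have "18 * exp (- 6 :: real) \<le> 1 / 2" by (simp add: exp_minus field_simps)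
    then show ?thesis by (intro power_mono) auto
  qed
  also have "\<dots> \<le> (1 / 2) ^ 1" using m by (intro power_decreasing) auto
  finally have "r ^ d * (2 * exp 2 * (real (d + m) * (1 - r) / real m)) ^ m \<le> 1 / 2" by simp
  then have "r ^ d * (2 * exp 2 * (real (d + m) * (1 - r) / real m)) ^ m
      * cube_norm n p (walsh_sum n x) \<le> 1 / 2 * cube_norm n p (walsh_sum n x)"
    by (intro mult_right_mono) auto
  moreover have "cube_norm n p (walsh_sum n (\<lambda>A. r ^ card A *\<^sub>R x A))
      \<le> r ^ d * (2 * exp 2 * (real (d + m) * (1 - r) / real m)) ^ m * cube_norm n p (walsh_sum n x)"
    using r_le supp by (intro noise_extrapolation[OF p d m]) (auto simp: r_def)
  ultimately show ?thesis by (simp add: r_def y_def)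
qed

section \<open>Lower bound for the Laplacian\<close>

text \<open>Splitting \<open>f\<close> into its displacement under the noise operator at time
  \<open>T = 8 m / d\<close> and its image, whose norm is at most half that of \<open>f\<close> and can be absorbed.\<close>
lemma laplacian_lower_bound:
  fixes f :: "(nat \<Rightarrow> real) \<Rightarrow> 'a::real_normed_vector"
  assumes p: "1 \<le> p" and d: "1 \<le> d" and m: "1 \<le> m"
    and deg: "degree_at_most n (d + m) f" and tail: "in_tail_space n d f"
  shows "1 / 16 * (real d / real m) * cube_norm n p f \<le> cube_norm n p (laplacian n f)"
proof -
  define x where "x = walsh_coeff n f"
  define T where "T = 8 * real m / real d"
  have T: "0 < T" using d m by (simp add: T_def)
  have supp: "d \<le> card A \<and> card A \<le> d + m" if "A \<subseteq> {1..n}" "x A \<noteq> 0" for A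
    using that deg tail unfolding degree_at_most_def in_tail_space_def x_def
    by (meson not_le)
  have f: "cube_norm n p f = cube_norm n p (walsh_sum n x)"
    unfolding x_def by (intro cube_norm_cong) (simp add: walsh_expansion)
  have lap: "laplacian n f = walsh_sum n (\<lambda>A. real (card A) *\<^sub>R x A)"
    by (simp add: fun_eq_iff laplacian_def walsh_sum_def x_def mult_ac)
  have "cube_norm n p (walsh_sum n x)
      = cube_norm n p (walsh_sum n (\<lambda>A. (1 - exp (- T) ^ card A) *\<^sub>R x A + exp (- T) ^ card A *\<^sub>R x A))"
    by (simp add: scaleR_left_diff_distrib)
  also have "\<dots> \<le> cube_norm n p (walsh_sum n (\<lambda>A. (1 - exp (- T) ^ card A) *\<^sub>R x A))
      + cube_norm n p (walsh_sum n (\<lambda>A. exp (- T) ^ card A *\<^sub>R x A))"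
    by (rule cube_norm_walsh_sum_triangle[OF p])
  also have "\<dots> \<le> T * cube_norm n p (laplacian n f) + 1 / 2 * cube_norm n p (walsh_sum n x)"
    unfolding lap T_def using supp T
    by (intro add_mono noise_displacement noise_halves_norm p d m) (auto simp: T_def)
  finally have "cube_norm n p f \<le> 2 * T * cube_norm n p (laplacian n f)" by (simp add: f)
  then show ?thesis using d m by (simp add: T_def field_simps)
qed

theorem theorem10:
  fixes p :: real
  assumes "K_convex TYPE('a::complex_banach)"
    and "1 < p"
  shows "\<exists>c>0. \<forall>n d m :: nat. \<forall>f :: (nat \<Rightarrow> real) \<Rightarrow> 'a.
           1 \<le> n \<longrightarrow> 1 \<le> d \<longrightarrow> 1 \<le> m \<longrightarrow> d + m \<le> n \<longrightarrow>
           degree_at_most n (d + m) f \<longrightarrow> in_tail_space n d f \<longrightarrow>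
           cube_norm n p (laplacian n f) \<ge> c * (real d / real m) * cube_norm n p f"
  using laplacian_lower_bound[where p = p] assms(2)
  by (intro exI[of _ "1 / 16"]) auto

end
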